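(* Let $m\ge 2$ and let $n\ge 3$ be an odd integer. Then $\chi_{lat}(A(mK_n,K_1))=n$.
   Context: All graphs are finite and simple. For a graph $G$ with $p$ vertices and $q$ edges, a local antimagic total labeling of $G$ is a bijection $f:V(G)\cup E(G)\to\{1,2,\ldots,p+q\}$ such that $w_f(u)\neq w_f(v)$ for every edge $uv\in E(G)$, where $w_f(u)=f(u)+\sum_{uv\in E(G)}f(uv)$ is the weight of $u$ (the sum is over all edges incident to $u$). The local antimagic total chromatic number $\chi_{lat}(G)$ is the minimum, over all local antimagic total labelings $f$ of $G$, of the number of distinct values of $w_f$ on $V(G)$. (It is known that every graph has a local antimagic total labeling.) $A(mK_n,K_1)$ denotes the amalgamation (one-point union) of $m$ copies of the complete graph $K_n$ over $K_1$: the simple graph obtained from $m$ disjoint copies of $K_n$ by choosing one vertex in each copy and identifying these $m$ vertices into a single vertex. Equivalently, it is the join $(mK_{n-1})\vee K_1$, where $mK_{n-1}$ is the disjoint union of $m$ copies of $K_{n-1}$. *)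

theory Defs
  imports Main
begin

record 'a sgraph =
  verts :: "'a set"
  edges :: "'a set set"

definition finite_simple_graph :: "'a sgraph \<Rightarrow> bool" where
  "finite_simple_graph G \<longleftrightarrow>
     finite (verts G) \<and> (\<forall>e \<in> edges G. e \<subseteq> verts G \<and> card e = 2)"

text \<open>A total labeling acts on the disjoint sum of vertices and edges, so that a vertex and an
  edge can never be confused.\<close>

definition weight :: "'a sgraph \<Rightarrow> ('a + 'a set \<Rightarrow> nat) \<Rightarrow> 'a \<Rightarrow> nat" where
  "weight G f u = f (Inl u) + (\<Sum>e \<in> {e \<in> edges G. u \<in> e}. f (Inr e))"

definition local_antimagic_total_labeling :: "'a sgraph \<Rightarrow> ('a + 'a set \<Rightarrow> nat) \<Rightarrow> bool" where
  "local_antimagic_total_labeling G f \<longleftrightarrow>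
     bij_betw f (verts G <+> edges G) {1..card (verts G) + card (edges G)} \<and>
     (\<forall>u v. {u, v} \<in> edges G \<longrightarrow> weight G f u \<noteq> weight G f v)"

text \<open>The infimum is a minimum as soon as one labeling exists. Since \<open>Inf {} = 0\<close> on the
  naturals, a positive value of \<open>chi_lat G\<close> entails that existence.\<close>

definition chi_lat :: "'a sgraph \<Rightarrow> nat" where
  "chi_lat G = Inf {card (weight G f ` verts G) | f. local_antimagic_total_labeling G f}"

definition complete_graph :: "nat \<Rightarrow> nat sgraph" where
  "complete_graph n =
     \<lparr>verts = {..<n}, edges = {{u, v} | u v. u < n \<and> v < n \<and> u \<noteq> v}\<rparr>"

definition disjoint_copies :: "nat \<Rightarrow> 'a sgraph \<Rightarrow> (nat \<times> 'a) sgraph" where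
  "disjoint_copies m G =
     \<lparr>verts = {..<m} \<times> verts G, edges = {Pair i ` e | i e. i < m \<and> e \<in> edges G}\<rparr>"

text \<open>One-point union of \<open>m\<close> copies of \<open>G\<close>: the copies of the root \<open>r\<close> are all identified
  with the single vertex \<open>None\<close>, and every other vertex \<open>(i, v)\<close> becomes \<open>Some (i, v)\<close>.\<close>

definition glue :: "'a \<Rightarrow> nat \<times> 'a \<Rightarrow> (nat \<times> 'a) option" where
  "glue r x = (if snd x = r then None else Some x)"

definition amalgamation :: "nat \<Rightarrow> 'a sgraph \<Rightarrow> 'a \<Rightarrow> (nat \<times> 'a) option sgraph" where
  "amalgamation m G r =
     \<lparr>verts = glue r ` verts (disjoint_copies m G),
      edges = image (glue r) ` edges (disjoint_copies m G)\<rparr>"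

text \<open>All vertices of a complete graph are alike, so the chosen vertex of each copy may be taken
  to be \<open>0\<close>. This requires \<open>n > 0\<close>.\<close>

definition amalgamated_complete_graphs :: "nat \<Rightarrow> nat \<Rightarrow> (nat \<times> nat) option sgraph" where
  "amalgamated_complete_graphs m n = amalgamation m (complete_graph n) 0"

lemma finite_simple_amalgamated_complete_graphs:
  "finite_simple_graph (amalgamated_complete_graphs m n)"
proof -
  have "e \<subseteq> verts (amalgamated_complete_graphs m n) \<and> card e = 2"
    if e: "e \<in> edges (amalgamated_complete_graphs m n)" for e
  proof -
    obtain i u v where "e = {glue 0 (i, u), glue 0 (i, v)}" "i < m" "u < n" "v < n" "u \<noteq> v"
      using e
      by (auto simp: amalgamated_complete_graphs_def amalgamation_def disjoint_copies_def
            complete_graph_def)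
    then show ?thesis
      by (auto simp: amalgamated_complete_graphs_def amalgamation_def disjoint_copies_def
            complete_graph_def glue_def card_2_iff)
  qed
  then show ?thesis
    by (auto simp: finite_simple_graph_def amalgamated_complete_graphs_def amalgamation_def
          disjoint_copies_def complete_graph_def)
qed

lemma verts_amalgamated_complete_graphs:
  assumes "m > 0" "n > 0"
  shows "verts (amalgamated_complete_graphs m n) = insert None (Some ` ({..<m} \<times> {1..<n}))"
  using assms
  by (force simp: amalgamated_complete_graphs_def amalgamation_def disjoint_copies_def
        complete_graph_def glue_def image_iff)

end

theory Submission
  imports Defs Complex_Main
begin

text \<open>
  Write \<open>n = 2h + 1\<close>. One copy of \<open>K\<^sub>n\<close> is a clique of \<open>n\<close> vertices, so every local antimagic
  total labeling has at least \<open>n\<close> weights (\<open>card_weights_ge\<close>). It remains to find a labeling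
  whose weights depend only on the position of a vertex inside its copy.

  Number the positions in \<open>K\<^sub>n\<close> from \<open>0\<close> to \<open>2h\<close>, the last one being the hub, the vertex common
  to all copies. Each edge position \<open>{u, v}\<close> gets a block of \<open>m\<close> consecutive labels, which is handed
  out to the copies \<open>0, \<dots>, m - 1\<close> in ascending or descending order, so that
  passing to the next copy changes the label by \<open>+1\<close> or \<open>-1\<close>. Let the order be descending
  exactly when \<open>u\<close> and \<open>v\<close> are distinct from the hub and have the same parity. A non-hub position then
  lies on \<open>h - 1\<close> descending edges and on \<open>h + 1\<close> ascending ones, \<open>h\<close> to
  positions of the other parity and one to the hub: its edges contribute \<open>+2\<close> per copy. The
  vertex labels have to make up for this with \<open>-2\<close> per copy, and this is possible because the number of
  non-hub positions is even: positions \<open>2j\<close> and \<open>2j + 1\<close> share a block of \<open>2m\<close> labels, and each of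
  the two takes every second label, downwards. So the weight of a non-hub vertex
  does not depend on its copy (\<open>weight_point_eq\<close>), and at most \<open>n\<close> weights occur.

  Two positions of a copy get different weights because the blocks are arranged monotonically:
  the edge blocks follow the colexicographic order, so replacing a position by a larger one
  increases every label that contributes to the weight, except for the label of the edge between
  the two positions, which they share (\<open>weight_point_less\<close>). With the hub as the largest position, the
  edges at the hub carry larger labels than all other edges. As there are at least two
  copies, the edges from the hub to a second copy already outweigh, term by term, the
  labels around a non-hub vertex other than that of its own edge to the hub, which counts for
  both weights (\<open>weight_point_less_hub\<close>).
\<close>

section \<open>Adjacency in the amalgamation\<close>

text \<open>The vertex at position \<open>p \<le> 2h\<close> of copy \<open>i\<close>. The order of the positions is reversed so that
  the glued vertex, which has number \<open>0\<close> in the complete graph, becomes the largest position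
  \<open>2h\<close>, in every copy \<open>i\<close>.\<close>

definition point :: "nat \<Rightarrow> nat \<Rightarrow> nat \<Rightarrow> (nat \<times> nat) option" where
  "point h i p = glue 0 (i, 2 * h - p)"

lemma point_eq_iff:
  assumes "p \<le> 2 * h" "q \<le> 2 * h"
  shows "point h i p = point h j q \<longleftrightarrow> p = q \<and> (p = 2 * h \<or> i = j)"
  using assms by (auto simp: point_def glue_def)

lemma edges_amalgamated_complete_graphs:
  "edges (amalgamated_complete_graphs m (Suc (2 * h))) =
     {{point h i u, point h i v} | i u v. i < m \<and> u < v \<and> v \<le> 2 * h}" (is "?E = ?R")
proof
  show "?R \<subseteq> ?E"
  proof
    fix e assume "e \<in> ?R"
    then obtain i u v where e: "e = {point h i u, point h i v}" "i < m" "u < v" "v \<le> 2 * h"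
      by auto
    have "{2 * h - u, 2 * h - v} \<in> edges (complete_graph (Suc (2 * h)))" (is "?d \<in> _")
      using e by (fastforce simp: complete_graph_def)
    then have "Pair i ` ?d \<in> edges (disjoint_copies m (complete_graph (Suc (2 * h))))"
      using e(2) by (simp only: disjoint_copies_def sgraph.simps) blast
    moreover have "e = glue 0 ` Pair i ` ?d"
      by (simp add: e point_def)
    ultimately show "e \<in> ?E"
      by (simp only: amalgamated_complete_graphs_def amalgamation_def sgraph.simps) (rule imageI)
  qed
  show "?E \<subseteq> ?R"
  proof
    fix e assume "e \<in> ?E"
    then obtain i a b where e: "e = {glue 0 (i, a), glue 0 (i, b)}" "i < m"
        "a < Suc (2 * h)" "b < Suc (2 * h)" "a \<noteq> b"
      by (auto simp: amalgamated_complete_graphs_def amalgamation_def disjoint_copies_def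
            complete_graph_def)
    have R: "{glue 0 (i, a), glue 0 (i, b)} \<in> ?R"
      if "a < b" "b < Suc (2 * h)" for a b
    proof -
      have "{glue 0 (i, a), glue 0 (i, b)} = {point h i (2 * h - b), point h i (2 * h - a)}"
        using that by (simp add: point_def insert_commute)
      moreover have "2 * h - b < 2 * h - a" "2 * h - a \<le> 2 * h"
        using that by auto
      ultimately show ?thesis
        using e(2) by blast
    qed
    show "e \<in> ?R"
    proof (cases "a < b")
      case True
      then show ?thesis
        using R e by simp
    next
      case False
      then show ?thesis
        using R[of b a] e by (simp add: insert_commute)
    qed
  qed
qed

lemma edgeI:
  assumes "i < m" "u \<le> 2 * h" "v \<le> 2 * h" "u \<noteq> v"
  shows "{point h i u, point h i v} \<in> edges (amalgamated_complete_graphs m (Suc (2 * h)))"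
proof (cases "u < v")
  case True
  then show ?thesis
    using assms by (auto simp: edges_amalgamated_complete_graphs)
next
  case False
  then have "v < u"
    using assms by simp
  then show ?thesis
    using assms by (subst insert_commute) (auto simp: edges_amalgamated_complete_graphs)
qed

lemma verts_eq_points:
  assumes "m > 0"
  shows "verts (amalgamated_complete_graphs m (Suc (2 * h))) =
    insert (point h 0 (2 * h)) ((\<lambda>(p, i). point h i p) ` ({..<2 * h} \<times> {..<m}))" (is "_ = ?R")
proof -
  have "Some (i, w) \<in> ?R" if "i < m" "1 \<le> w" "w \<le> 2 * h" for i w
  proof -
    have "Some (i, w) = (\<lambda>(p, i). point h i p) (2 * h - w, i)"
      using that by (auto simp: point_def glue_def)
    then show ?thesis
      using that by (intro insertI2 rev_image_eqI[of "(2 * h - w, i)"]) auto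
  qed
  moreover have "?R \<subseteq> insert None (Some ` ({..<m} \<times> {1..<Suc (2 * h)}))"
    by (auto simp: point_def glue_def Suc_le_eq less_Suc_eq_le intro!: imageI)
  ultimately show ?thesis
    using assms by (subst verts_amalgamated_complete_graphs) (auto simp: point_def glue_def)
qed

lemma point_in_verts:
  assumes "i < m" "p \<le> 2 * h"
  shows "point h i p \<in> verts (amalgamated_complete_graphs m (Suc (2 * h)))"
proof (cases "p = 2 * h")
  case True
  then show ?thesis
    using assms by (subst verts_eq_points) (auto simp: point_eq_iff)
next
  case False
  then show ?thesis
    using assms by (subst verts_eq_points) (auto intro!: rev_image_eqI[of "(p, i)"])
qed

lemma incident_edges:
  assumes "i < m" "p < 2 * h"
  shows "{e \<in> edges (amalgamated_complete_graphs m (Suc (2 * h))). point h i p \<in> e} =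
    (\<lambda>q. {point h i q, point h i p}) ` ({..2 * h} - {p})" (is "?L = ?R")
proof
  show "?R \<subseteq> ?L"
    using assms by (auto intro: edgeI)
  show "?L \<subseteq> ?R"
  proof
    fix e assume "e \<in> ?L"
    then obtain j u v where e: "e = {point h j u, point h j v}" "u < v" "v \<le> 2 * h"
        and "point h i p \<in> e"
      by (auto simp: edges_amalgamated_complete_graphs)
    then have "i = j" "p = u \<or> p = v"
      using assms by (auto simp: point_eq_iff)
    then show "e \<in> ?R"
      using e by auto
  qed
qed

lemma incident_edges_hub:
  "{e \<in> edges (amalgamated_complete_graphs m (Suc (2 * h))). point h 0 (2 * h) \<in> e} =
    (\<lambda>(i, q). {point h i q, point h i (2 * h)}) ` ({..<m} \<times> {..<2 * h})" (is "?L = ?R")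
proof
  show "?R \<subseteq> ?L"
    by (auto intro!: edgeI simp: point_eq_iff)
  show "?L \<subseteq> ?R"
  proof
    fix e assume "e \<in> ?L"
    then obtain j u v where e: "e = {point h j u, point h j v}" "j < m" "u < v" "v \<le> 2 * h"
        and "point h 0 (2 * h) \<in> e"
      by (auto simp: edges_amalgamated_complete_graphs)
    then have "v = 2 * h"
      by (auto simp: point_eq_iff)
    then show "e \<in> ?R"
      using e by auto
  qed
qed

text \<open>The vertices of copy \<open>0\<close>, hub included, are pairwise adjacent, so their weights differ.\<close>

lemma card_weights_ge:
  assumes lab: "local_antimagic_total_labeling (amalgamated_complete_graphs m (Suc (2 * h))) f"
    and "m > 0"
  shows "Suc (2 * h) \<le> card (weight (amalgamated_complete_graphs m (Suc (2 * h))) f `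
    verts (amalgamated_complete_graphs m (Suc (2 * h))))" (is "_ \<le> card (?w ` ?V)")
proof -
  have "inj_on (\<lambda>p. ?w (point h 0 p)) {..2 * h}"
  proof (rule inj_onI, rule ccontr)
    fix p q assume "p \<in> {..2 * h}" "q \<in> {..2 * h}" "?w (point h 0 p) = ?w (point h 0 q)" "p \<noteq> q"
    moreover from this have "{point h 0 p, point h 0 q} \<in>
        edges (amalgamated_complete_graphs m (Suc (2 * h)))"
      using assms by (intro edgeI) auto
    ultimately show False
      using lab by (auto simp: local_antimagic_total_labeling_def)
  qed
  then have "Suc (2 * h) = card ((\<lambda>p. ?w (point h 0 p)) ` {..2 * h})"
    by (simp add: card_image)
  also have "\<dots> \<le> card (?w ` ?V)"
  proof (rule card_mono)
    show "finite (?w ` ?V)"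
      using finite_simple_amalgamated_complete_graphs by (auto simp: finite_simple_graph_def)
    show "(\<lambda>p. ?w (point h 0 p)) ` {..2 * h} \<subseteq> ?w ` ?V"
      using assms by (auto intro!: imageI point_in_verts)
  qed
  finally show ?thesis .
qed

section \<open>Numbering by blocks\<close>

text \<open>Division with remainder by \<open>m\<close>, where each block \<open>t\<close> may permute its \<open>m\<close> numbers by its own
  \<open>s t\<close>.\<close>

lemma bij_betw_blocks:
  assumes a: "bij_betw a T {..<k}"
    and s: "\<And>t. t \<in> T \<Longrightarrow> bij_betw (s t) {..<m} {..<m :: nat}"
  shows "bij_betw (\<lambda>(t, i). a t * m + s t i) (T \<times> {..<m}) {..<k * m}"
proof (rule bij_betw_imageI)
  have div_mod: "(a t * m + s t i) div m = a t" "(a t * m + s t i) mod m = s t i" "s t i < m"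
    if "t \<in> T" "i < m" for t i
    using bij_betwE[OF s[OF that(1)]] that by auto
  show "inj_on (\<lambda>(t, i). a t * m + s t i) (T \<times> {..<m})"
  proof (rule inj_onI)
    fix x x' assume x: "x \<in> T \<times> {..<m}" "x' \<in> T \<times> {..<m}"
      and eq: "(\<lambda>(t, i). a t * m + s t i) x = (\<lambda>(t, i). a t * m + s t i) x'"
    obtain t i t' i' where *: "x = (t, i)" "x' = (t', i')" "t \<in> T" "t' \<in> T" "i < m" "i' < m"
      using x by auto
    have "a t * m + s t i = a t' * m + s t' i'"
      using eq * by simp
    then have at: "a t = a t'" and st: "s t i = s t' i'"
      using div_mod[OF *(3,5)] div_mod[OF *(4,6)] by metis+
    have t: "t = t'"
      using inj_onD[OF bij_betw_imp_inj_on[OF a] at *(3,4)] .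
    have "i = i'"
      using inj_onD[OF bij_betw_imp_inj_on[OF s[OF *(3)]], of i i'] st t * by simp
    then show "x = x'"
      using t * by simp
  qed
  show "(\<lambda>(t, i). a t * m + s t i) ` (T \<times> {..<m}) = {..<k * m}"
  proof (intro equalityI subsetI)
    fix y assume "y \<in> (\<lambda>(t, i). a t * m + s t i) ` (T \<times> {..<m})"
    then obtain t i where *: "t \<in> T" "i < m" "y = a t * m + s t i"
      by auto
    have "a t + 1 \<le> k"
      using bij_betwE[OF a] * by force
    then have "(a t + 1) * m \<le> k * m"
      by (rule mult_le_mono1)
    then show "y \<in> {..<k * m}"
      using div_mod(3)[of t i] * by simp
  next
    fix y assume y: "y \<in> {..<k * m}"
    then have "y div m \<in> {..<k}"
      by (simp add: less_mult_imp_div_less)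
    then obtain t where t: "t \<in> T" "a t = y div m"
      using a by (metis bij_betw_imp_surj_on imageE)
    have "y mod m \<in> {..<m}"
      using y by (cases m) auto
    then obtain i where i: "i \<in> {..<m}" "s t i = y mod m"
      using s[OF t(1)] by (metis bij_betw_imp_surj_on imageE)
    have "y = (\<lambda>(t, i). a t * m + s t i) (t, i)"
      using t i by simp
    then show "y \<in> (\<lambda>(t, i). a t * m + s t i) ` (T \<times> {..<m})"
      using t i by blast
  qed
qed

lemma bij_betw_reverse: "bij_betw (\<lambda>i. m - 1 - i) {..<m} {..<m :: nat}"
  by (rule bij_betw_byWitness[where f' = "\<lambda>i. m - 1 - i"]) auto

lemma bij_betw_shift: "bij_betw (\<lambda>x. x + c) {..<n} {c..<c + n :: nat}"
  by (rule bij_betw_byWitness[where f' = "\<lambda>x. x - c"]) auto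

text \<open>Vertices and edges are given by a parametrization \<open>g\<close>, and labels by a bijection \<open>l\<close> on the
  parameters. Injectivity of \<open>f \<circ> g = l\<close> makes \<open>f\<close> injective on the
  image of \<open>g\<close>.\<close>

lemma bij_betw_along_parametrization:
  assumes "bij_betw l X I" and "\<And>x. x \<in> X \<Longrightarrow> f (g x) = l x"
  shows "bij_betw f (g ` X) I"
proof -
  have "bij_betw (f \<circ> g) X I"
    using assms by (auto cong: bij_betw_cong)
  then show ?thesis
    by (auto simp: bij_betw_def image_comp dest: inj_on_imageI)
qed

text \<open>The number of the pair \<open>{u, v}\<close> in the colexicographic enumeration of the two-element sets of
  naturals. Among the pairs below \<open>k\<close>, those that contain \<open>k - 1\<close> come last, and all pairs below
  \<open>k\<close> together take up an initial segment.\<close>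

definition rank :: "nat \<Rightarrow> nat \<Rightarrow> nat" where
  "rank u v = (max u v choose 2) + min u v"

lemma Suc_choose_two: "Suc n choose 2 = (n choose 2) + n"
  by (simp add: numeral_2_eq_2)

lemma rank_commute: "rank u v = rank v u"
  by (simp add: rank_def max.commute min.commute)

lemma rank_strict_mono:
  assumes "u < v" "w \<noteq> u" "w \<noteq> v"
  shows "rank u w < rank v w"
proof -
  consider "w < u" | "u < w" "w < v" | "v < w"
    using assms by linarith
  then show ?thesis
  proof cases
    case 1
    have "Suc u choose 2 \<le> v choose 2"
      using assms by (intro binomial_right_mono) simp
    then show ?thesis
      using 1 assms by (simp add: rank_def Suc_choose_two max_def min_def)
  next
    case 2
    have "w choose 2 \<le> v choose 2"
      using 2 by (intro binomial_right_mono) simp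
    then show ?thesis
      using 2 by (simp add: rank_def max_def min_def)
  next
    case 3
    then show ?thesis
      using assms by (simp add: rank_def max_def min_def)
  qed
qed

lemma bij_betw_rank:
  "bij_betw (\<lambda>(u, v). rank u v) {(u, v). u < v \<and> v < k} {..<k choose 2}"
proof (induction k)
  case 0
  then show ?case
    by (simp add: bij_betw_def numeral_2_eq_2)
next
  case (Suc k)
  have "bij_betw (\<lambda>(u, v). rank u v) ((\<lambda>u. (u, k)) ` {..<k}) {k choose 2..<(k choose 2) + k}"
    by (rule bij_betw_along_parametrization[OF bij_betw_shift]) (simp add: rank_def)
  with Suc have "bij_betw (\<lambda>(u, v). rank u v)
      ({(u, v). u < v \<and> v < k} \<union> (\<lambda>u. (u, k)) ` {..<k})
      ({..<k choose 2} \<union> {k choose 2..<(k choose 2) + k})"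
    by (rule bij_betw_combine) auto
  moreover have "{(u, v). u < v \<and> v < k} \<union> (\<lambda>u. (u, k)) ` {..<k} = {(u, v). u < v \<and> v < Suc k}"
    by (auto simp: less_Suc_eq)
  moreover have "{..<k choose 2} \<union> {k choose 2..<(k choose 2) + k} = {..<Suc k choose 2}"
    by (auto simp: Suc_choose_two)
  ultimately show ?case
    by metis
qed

section \<open>The labeling\<close>

text \<open>Here \<open>p\<close> is a non-hub position and \<open>i\<close> a copy. The positions \<open>2j\<close> and \<open>2j + 1\<close> take alternate
  labels of the same block of size \<open>2m\<close>, so that the label drops by \<open>2\<close> from one copy to the
  next.\<close>

definition vertex_label :: "nat \<Rightarrow> nat \<Rightarrow> nat \<Rightarrow> nat" where
  "vertex_label m i p = ((p div 2) * m + (m - 1 - i)) * 2 + p mod 2 + 1"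

definition descending :: "nat \<Rightarrow> nat \<Rightarrow> nat \<Rightarrow> bool" where
  "descending h u v \<longleftrightarrow> u < 2 * h \<and> v < 2 * h \<and> even (u + v)"

text \<open>The edge labels come after the \<open>2hm\<close> vertex labels, and the hub label is the last one.\<close>

definition edge_label :: "nat \<Rightarrow> nat \<Rightarrow> nat \<Rightarrow> nat \<Rightarrow> nat \<Rightarrow> nat" where
  "edge_label h m i u v =
     rank u v * m + (if descending h u v then m - 1 - i else i) + (2 * h * m + 1)"

definition hub_label :: "nat \<Rightarrow> nat \<Rightarrow> nat" where
  "hub_label h m = (Suc (2 * h) choose 2) * m + (2 * h * m + 1)"

text \<open>An edge determines its two positions, and it determines its copy because one of its ends is not
  the hub. So exactly one value can be chosen (\<open>labeling_edge\<close>).\<close>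

definition labeling :: "nat \<Rightarrow> nat \<Rightarrow> (nat \<times> nat) option + (nat \<times> nat) option set \<Rightarrow> nat" where
  "labeling h m x = (case x of
       Inl None \<Rightarrow> hub_label h m
     | Inl (Some (i, w)) \<Rightarrow> vertex_label m i (2 * h - w)
     | Inr e \<Rightarrow> (SOME l. \<exists>i u v. u < v \<and> v \<le> 2 * h \<and>
         e = {point h i u, point h i v} \<and> l = edge_label h m i u v))"

lemma labeling_hub: "labeling h m (Inl (point h i (2 * h))) = hub_label h m"
  by (simp add: labeling_def point_def glue_def)

lemma labeling_vertex:
  assumes "p < 2 * h"
  shows "labeling h m (Inl (point h i p)) = vertex_label m i p"
  using assms by (simp add: labeling_def point_def glue_def)

lemma edge_label_commute: "edge_label h m i u v = edge_label h m i v u"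
  by (simp add: edge_label_def rank_commute descending_def add.commute conj_commute)

lemma labeling_edge:
  assumes "u \<le> 2 * h" "v \<le> 2 * h" "u \<noteq> v"
  shows "labeling h m (Inr {point h i u, point h i v}) = edge_label h m i u v"
proof -
  have *: "labeling h m (Inr {point h i u, point h i v}) = edge_label h m i u v"
    if "u < v" "v \<le> 2 * h" for u v
  proof -
    have "(\<exists>j a b. a < b \<and> b \<le> 2 * h \<and> {point h i u, point h i v} = {point h j a, point h j b} \<and>
        l = edge_label h m j a b) \<longleftrightarrow> l = edge_label h m i u v" for l
      using that by (auto simp: doubleton_eq_iff point_eq_iff)
    then show ?thesis
      by (simp add: labeling_def)
  qed
  show ?thesis
  proof (cases "u < v")
    case True
    then show ?thesis
      using * assms by simp
  next
    case False
    then show ?thesis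
      using *[of v u] assms by (simp add: insert_commute edge_label_commute)
  qed
qed

text \<open>Two nested block numberings: the pairs \<open>(j, i)\<close> are numbered by blocks of size \<open>m\<close>, and each of
  them is a block of size \<open>2\<close> for the positions \<open>2j\<close> and \<open>2j + 1\<close>.\<close>

lemma bij_betw_vertex_label:
  "bij_betw (\<lambda>(p, i). vertex_label m i p) ({..<2 * h} \<times> {..<m}) {1..<1 + 2 * h * m}"
proof -
  have "bij_betw (\<lambda>(j, i). j * m + (m - 1 - i)) ({..<h} \<times> {..<m}) {..<h * m}"
    using bij_betw_blocks[of id "{..<h}" h "\<lambda>_ i. m - 1 - i" m] bij_betw_reverse[of m]
    by simp
  then have "bij_betw (\<lambda>((j, i), b). (j * m + (m - 1 - i)) * 2 + b)
      (({..<h} \<times> {..<m}) \<times> {..<2}) {..<h * m * 2}"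
    using bij_betw_blocks[of "\<lambda>(j, i). j * m + (m - 1 - i)" "{..<h} \<times> {..<m}" "h * m" "\<lambda>_. id" 2]
    by (simp add: case_prod_unfold)
  moreover have "bij_betw (\<lambda>(p, i). ((p div 2, i), p mod 2)) ({..<2 * h} \<times> {..<m})
      (({..<h} \<times> {..<m}) \<times> {..<2})"
    by (rule bij_betw_byWitness[where f' = "\<lambda>((j, i), b). (2 * j + b, i)"]) auto
  ultimately have "bij_betw ((\<lambda>x. x + 1) \<circ> ((\<lambda>((j, i), b). (j * m + (m - 1 - i)) * 2 + b) \<circ>
      (\<lambda>(p, i). ((p div 2, i), p mod 2)))) ({..<2 * h} \<times> {..<m}) {1..<1 + h * m * 2}"
    by (intro bij_betw_trans[OF _ bij_betw_shift] bij_betw_trans)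
  then show ?thesis
    by (simp add: comp_def case_prod_unfold vertex_label_def ac_simps)
qed

lemma bij_betw_edge_label:
  "bij_betw (\<lambda>((u, v), i). edge_label h m i u v) ({(u, v). u < v \<and> v < Suc (2 * h)} \<times> {..<m})
     {2 * h * m + 1..<hub_label h m}"
proof -
  let ?s = "\<lambda>(u, v) i. if descending h u v then m - 1 - i else i"
  have "bij_betw (?s t) {..<m} {..<m}" for t
    using bij_betw_reverse[of m] by (cases t; cases "descending h (fst t) (snd t)")
      (auto simp: bij_betw_id[unfolded id_def])
  from bij_betw_blocks[OF bij_betw_rank[of "Suc (2 * h)"] this]
  have "bij_betw (\<lambda>((u, v), i). rank u v * m + (if descending h u v then m - 1 - i else i))
      ({(u, v). u < v \<and> v < Suc (2 * h)} \<times> {..<m}) {..<(Suc (2 * h) choose 2) * m}"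
    by (simp add: case_prod_unfold)
  from bij_betw_trans[OF this bij_betw_shift[of "2 * h * m + 1"]] show ?thesis
    by (simp add: comp_def case_prod_unfold edge_label_def hub_label_def ac_simps)
qed

text \<open>The vertices, the edges and the hub fill three consecutive intervals. That their total
  length is the number of vertices and edges is a consequence of the bijection itself.\<close>

lemma bij_betw_labeling:
  fixes m h :: nat
  assumes "m > 0"
  defines "G \<equiv> amalgamated_complete_graphs m (Suc (2 * h))"
  shows "bij_betw (labeling h m) (verts G <+> edges G) {1..card (verts G) + card (edges G)}"
proof -
  let ?P = "{..<2 * h} \<times> {..<m}" and ?T = "{(u, v). u < v \<and> v < Suc (2 * h)} \<times> {..<m}"
  let ?v = "\<lambda>(p, i). Inl (point h i p)" and ?e = "\<lambda>((u, v), i). Inr {point h i u, point h i v}"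
  have "bij_betw (labeling h m) (?v ` ?P) {1..<1 + 2 * h * m}"
    by (rule bij_betw_along_parametrization[OF bij_betw_vertex_label]) (auto simp: labeling_vertex)
  moreover have "bij_betw (labeling h m) (?e ` ?T) {2 * h * m + 1..<hub_label h m}"
    by (rule bij_betw_along_parametrization[OF bij_betw_edge_label]) (auto simp: labeling_edge)
  ultimately have "bij_betw (labeling h m) (?v ` ?P \<union> ?e ` ?T)
      ({1..<1 + 2 * h * m} \<union> {2 * h * m + 1..<hub_label h m})"
    by (rule bij_betw_combine) auto
  moreover have "bij_betw (labeling h m) {Inl (point h 0 (2 * h))} {hub_label h m}"
    by (simp add: labeling_hub)
  ultimately have "bij_betw (labeling h m) (?v ` ?P \<union> ?e ` ?T \<union> {Inl (point h 0 (2 * h))})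
      ({1..<1 + 2 * h * m} \<union> {2 * h * m + 1..<hub_label h m} \<union> {hub_label h m})"
    by (rule bij_betw_combine) (auto simp: hub_label_def)
  moreover have "?v ` ?P \<union> ?e ` ?T \<union> {Inl (point h 0 (2 * h))} = verts G <+> edges G"
    unfolding G_def verts_eq_points[OF assms(1)] edges_amalgamated_complete_graphs
    by (force simp: Plus_def less_Suc_eq_le image_iff)
  moreover have "{1..<1 + 2 * h * m} \<union> {2 * h * m + 1..<hub_label h m} \<union> {hub_label h m} =
      {1..hub_label h m}"
    by (auto simp: hub_label_def)
  ultimately have *: "bij_betw (labeling h m) (verts G <+> edges G) {1..hub_label h m}"
    by metis
  then have "finite (verts G <+> edges G)"
    using bij_betw_finite by blast
  then have "card (verts G) + card (edges G) = hub_label h m"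
    using bij_betw_same_card[OF *] by (simp add: card_Plus finite_Plus_iff)
  then show ?thesis
    using * by simp
qed

section \<open>The weights\<close>

lemma weight_point:
  assumes "i < m" "p < 2 * h"
  shows "weight (amalgamated_complete_graphs m (Suc (2 * h))) (labeling h m) (point h i p) =
    vertex_label m i p + (\<Sum>q\<in>{..2 * h} - {p}. edge_label h m i q p)"
proof -
  have "inj_on (\<lambda>q. {point h i q, point h i p}) ({..2 * h} - {p})"
    using assms by (auto simp: inj_on_def doubleton_eq_iff point_eq_iff)
  then show ?thesis
    using assms unfolding weight_def incident_edges[OF assms]
    by (subst sum.reindex) (auto simp: labeling_vertex labeling_edge intro!: sum.cong)
qed

lemma weight_hub:
  "weight (amalgamated_complete_graphs m (Suc (2 * h))) (labeling h m) (point h 0 (2 * h)) =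
    hub_label h m + (\<Sum>i<m. \<Sum>q<2 * h. edge_label h m i q (2 * h))"
proof -
  have "inj_on (\<lambda>(i, q). {point h i q, point h i (2 * h)}) ({..<m} \<times> {..<2 * h})"
    by (auto simp: inj_on_def doubleton_eq_iff point_eq_iff)
  then show ?thesis
    unfolding weight_def incident_edges_hub sum.cartesian_product
    by (subst sum.reindex) (auto simp: labeling_hub labeling_edge intro!: sum.cong)
qed

lemma sum_by_parity: "(\<Sum>q<2 * h. if even (q + p) then a else b) = h * a + h * (b :: nat)"
  by (induction h) auto

text \<open>The balance of ascending and descending edges at position \<open>p\<close>. Among the \<open>2h\<close> non-hub positions
  both parities occur \<open>h\<close> times; leaving out \<open>p\<close> itself removes one descending term and the hub
  adds one ascending term. The summand \<open>2 * (m - 1 - i)\<close> is the part of the vertex label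
  that depends on the copy.\<close>

lemma sum_offsets:
  assumes "p < 2 * h" "i < m"
  shows "(\<Sum>q\<in>{..2 * h} - {p}. if descending h q p then m - 1 - i else i) + 2 * (m - 1 - i) =
    Suc h * (m - 1)"
proof -
  define a where "a = m - 1 - i"
  let ?g = "\<lambda>q. if even (q + p) then a else i"
  have "{..2 * h} - {p} = insert (2 * h) ({..<2 * h} - {p})"
    using assms by auto
  then have "(\<Sum>q\<in>{..2 * h} - {p}. if descending h q p then a else i) =
      i + (\<Sum>q\<in>{..<2 * h} - {p}. if descending h q p then a else i)"
    by (simp add: descending_def)
  also have "(\<Sum>q\<in>{..<2 * h} - {p}. if descending h q p then a else i) = sum ?g ({..<2 * h} - {p})"
    using assms by (intro sum.cong) (auto simp: descending_def)
  finally have "(\<Sum>q\<in>{..2 * h} - {p}. if descending h q p then a else i) + a = i + sum ?g {..<2 * h}"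
    using assms by (simp add: sum.remove[of "{..<2 * h}" p])
  also have "\<dots> = i + h * a + h * i"
    unfolding sum_by_parity by simp
  finally have "(\<Sum>q\<in>{..2 * h} - {p}. if descending h q p then a else i) + 2 * a =
      Suc h * (a + i)"
    by (simp add: algebra_simps)
  then show ?thesis
    using assms unfolding a_def by simp
qed

lemma weight_point_eq:
  assumes "i < m" "p < 2 * h"
  shows "weight (amalgamated_complete_graphs m (Suc (2 * h))) (labeling h m) (point h i p) =
    weight (amalgamated_complete_graphs m (Suc (2 * h))) (labeling h m) (point h 0 p)"
proof -
  have "weight (amalgamated_complete_graphs m (Suc (2 * h))) (labeling h m) (point h i p) =
      (p div 2) * m * 2 + p mod 2 + 1 + (\<Sum>q\<in>{..2 * h} - {p}. rank q p * m + (2 * h * m + 1)) +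
      Suc h * (m - 1)" if "i < m" for i
  proof -
    have "(\<Sum>q\<in>{..2 * h} - {p}. edge_label h m i q p) =
        (\<Sum>q\<in>{..2 * h} - {p}. rank q p * m + (2 * h * m + 1)) +
        (\<Sum>q\<in>{..2 * h} - {p}. if descending h q p then m - 1 - i else i)"
      unfolding sum.distrib[symmetric] by (intro sum.cong) (auto simp: edge_label_def)
    then show ?thesis
      unfolding weight_point[OF that assms(2)] sum_offsets[OF assms(2) that, symmetric]
      by (simp add: vertex_label_def)
  qed
  from this[OF assms(1)] this[of 0] show ?thesis
    using assms(1) by simp
qed

text \<open>The order of the blocks decides, whatever the copies are.\<close>

lemma edge_label_less:
  assumes "rank u v < rank u' v'" "i < m" "j < m"
  shows "edge_label h m i u v < edge_label h m j u' v'"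
proof -
  have "(if descending h u v then m - 1 - i else i) < m"
    using assms by auto
  then have "rank u v * m + (if descending h u v then m - 1 - i else i) < Suc (rank u v) * m"
    by simp
  also have "\<dots> \<le> rank u' v' * m"
    using assms by (intro mult_le_mono1) simp
  finally show ?thesis
    by (simp add: edge_label_def)
qed

lemma vertex_label_less:
  assumes "p < q" "i < m"
  shows "vertex_label m i p < vertex_label m i q"
proof (cases "p div 2 = q div 2")
  case True
  then have "p mod 2 < q mod 2"
    using assms by (metis add_less_cancel_left mult_div_mod_eq)
  then show ?thesis
    using True by (simp add: vertex_label_def)
next
  case False
  then have "Suc (p div 2) \<le> q div 2"
    using assms div_le_mono[of p q 2] by linarith
  then have "Suc (p div 2) * m \<le> (q div 2) * m"
    by (rule mult_le_mono1)
  then have "(p div 2) * m + 1 \<le> (q div 2) * m"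
    using assms by simp
  moreover have "p mod 2 < 2"
    by simp
  ultimately show ?thesis
    unfolding vertex_label_def add_mult_distrib by linarith
qed

lemma vertex_label_bound:
  assumes "p < 2 * h" "i < m"
  shows "vertex_label m i p < 2 * h * m + 1"
  using bij_betwE[OF bij_betw_vertex_label[of m h]] assms by fastforce

lemma weight_point_less:
  assumes "p < q" "q < 2 * h" "i < m"
  shows "weight (amalgamated_complete_graphs m (Suc (2 * h))) (labeling h m) (point h i p) <
    weight (amalgamated_complete_graphs m (Suc (2 * h))) (labeling h m) (point h i q)"
proof -
  let ?R = "{..2 * h} - {p} - {q}"
  have "(\<Sum>r\<in>{..2 * h} - {p}. edge_label h m i r p) =
      edge_label h m i q p + (\<Sum>r\<in>?R. edge_label h m i r p)"
    using assms by (intro sum.remove) auto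
  moreover have "(\<Sum>r\<in>{..2 * h} - {q}. edge_label h m i r q) =
      edge_label h m i p q + (\<Sum>r\<in>{..2 * h} - {q} - {p}. edge_label h m i r q)"
    using assms by (intro sum.remove) auto
  moreover have "{..2 * h} - {q} - {p} = ?R"
    by auto
  moreover have "(\<Sum>r\<in>?R. edge_label h m i r p) \<le> (\<Sum>r\<in>?R. edge_label h m i r q)"
    using assms rank_strict_mono[of p q]
    by (intro sum_mono less_imp_le edge_label_less) (auto simp: rank_commute)
  ultimately show ?thesis
    using assms vertex_label_less[of p q i m]
    by (simp add: weight_point edge_label_commute[of h m i q p])
qed

lemma weight_point_less_hub:
  assumes "p < 2 * h" "i < m" "m \<ge> 2"
  shows "weight (amalgamated_complete_graphs m (Suc (2 * h))) (labeling h m) (point h i p) <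
    weight (amalgamated_complete_graphs m (Suc (2 * h))) (labeling h m) (point h 0 (2 * h))"
proof -
  \<comment> \<open>Any copy other than \<open>i\<close> would do: its edges at the hub are compared with the labels around
    \<open>point h i p\<close>, apart from the edge from there to the hub, which itself occurs in both weights.\<close>
  define j where "j = (if i = 0 then 1 else 0 :: nat)"
  have j: "j < m" "j \<noteq> i"
    using assms by (auto simp: j_def)
  have H: "{..2 * h} - {p} = insert (2 * h) ({..<2 * h} - {p})"
    using assms by auto
  have "(\<Sum>q\<in>{..<2 * h} - {p}. edge_label h m i q p) \<le>
      (\<Sum>q\<in>{..<2 * h} - {p}. edge_label h m j q (2 * h))"
    using assms j rank_strict_mono[of p "2 * h"]
    by (intro sum_mono less_imp_le edge_label_less) (auto simp: rank_commute)
  moreover have "vertex_label m i p \<le> edge_label h m j p (2 * h)"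
    using vertex_label_bound[of p h i m] assms by (simp add: edge_label_def)
  moreover have "(\<Sum>q<2 * h. edge_label h m j q (2 * h)) =
      edge_label h m j p (2 * h) + (\<Sum>q\<in>{..<2 * h} - {p}. edge_label h m j q (2 * h))"
    using assms by (intro sum.remove) auto
  moreover have "edge_label h m i p (2 * h) \<le> (\<Sum>q<2 * h. edge_label h m i q (2 * h))"
    using assms by (intro member_le_sum) auto
  moreover have "(\<Sum>k\<in>{i, j}. \<Sum>q<2 * h. edge_label h m k q (2 * h)) \<le>
      (\<Sum>k<m. \<Sum>q<2 * h. edge_label h m k q (2 * h))"
    using assms j by (intro sum_mono2) auto
  moreover have "hub_label h m > 0"
    by (simp add: hub_label_def)
  ultimately show ?thesis
    using assms j by (simp add: weight_point weight_hub H edge_label_commute[of h m i "2 * h" p])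
qed

lemma local_antimagic_labeling:
  assumes "m \<ge> 2"
  shows "local_antimagic_total_labeling (amalgamated_complete_graphs m (Suc (2 * h))) (labeling h m)"
proof -
  let ?G = "amalgamated_complete_graphs m (Suc (2 * h))"
  have *: "weight ?G (labeling h m) (point h i u) < weight ?G (labeling h m) (point h i v)"
    if "i < m" "u < v" "v \<le> 2 * h" for i u v
  proof (cases "v = 2 * h")
    case True
    then have "point h i v = point h 0 (2 * h)"
      by (simp add: point_eq_iff)
    then show ?thesis
      using weight_point_less_hub[of u h i m] True that assms by simp
  next
    case False
    then show ?thesis
      using weight_point_less[of u v h i m] that by simp
  qed
  have "weight ?G (labeling h m) x \<noteq> weight ?G (labeling h m) y" if xy: "{x, y} \<in> edges ?G" for x y
  proof -
    obtain i u v where "{x, y} = {point h i u, point h i v}" "i < m" "u < v" "v \<le> 2 * h"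
      using xy unfolding edges_amalgamated_complete_graphs by blast
    then show ?thesis
      using *[of i u v] by (auto simp: doubleton_eq_iff)
  qed
  then show ?thesis
    using bij_betw_labeling[of m h] assms by (simp add: local_antimagic_total_labeling_def)
qed

lemma card_weights_le:
  assumes "m > 0"
  shows "card (weight (amalgamated_complete_graphs m (Suc (2 * h))) (labeling h m) `
    verts (amalgamated_complete_graphs m (Suc (2 * h)))) \<le> Suc (2 * h)" (is "card (?w ` ?V) \<le> _")
proof -
  have "?w ` ?V \<subseteq> (\<lambda>p. ?w (point h 0 p)) ` {..2 * h}"
  proof -
    have "?w x \<in> (\<lambda>p. ?w (point h 0 p)) ` {..2 * h}" if "x \<in> ?V" for x
    proof -
      have "x = point h 0 (2 * h) \<or> (\<exists>p i. x = point h i p \<and> p < 2 * h \<and> i < m)"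
        using that unfolding verts_eq_points[OF assms] by auto
      then consider "x = point h 0 (2 * h)" | p i where "x = point h i p" "p < 2 * h" "i < m"
        by blast
      then show ?thesis
      proof cases
        case 1
        then show ?thesis
          by simp
      next
        case (2 p i)
        then show ?thesis
          using weight_point_eq[of i m p h] by (intro rev_image_eqI[of p]) auto
      qed
    qed
    then show ?thesis
      by blast
  qed
  then have "card (?w ` ?V) \<le> card ((\<lambda>p. ?w (point h 0 p)) ` {..2 * h})"
    by (intro card_mono) auto
  also have "\<dots> \<le> card {..2 * h}"
    by (rule card_image_le) simp
  finally show ?thesis
    by simp
qed

theorem corollary2p10:
  fixes m n :: nat
  assumes "m \<ge> 2" and "n \<ge> 3" and "odd n"
  shows "chi_lat (amalgamated_complete_graphs m n) = n"
proof -
  obtain h where n: "n = Suc (2 * h)"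
    using assms(3) by (auto elim: oddE)
  let ?G = "amalgamated_complete_graphs m (Suc (2 * h))"
  let ?C = "{card (weight ?G f ` verts ?G) | f. local_antimagic_total_labeling ?G f}"
  have "card (weight ?G (labeling h m) ` verts ?G) \<in> ?C"
    using local_antimagic_labeling[of m h] assms by blast
  then have "Inf ?C \<le> Suc (2 * h)" "?C \<noteq> {}"
    using cInf_lower[of _ ?C] card_weights_le[of m h] assms by (auto intro: order_trans)
  moreover have "Suc (2 * h) \<le> Inf ?C"
    using \<open>?C \<noteq> {}\<close> card_weights_ge assms by (intro cInf_greatest) auto
  ultimately show ?thesis
    by (simp add: chi_lat_def n)
qed

end
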